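(* For an arbitrary subset $A\subset\mathbb{R}$, if $(\mathbb{R},\tau_A)$ is $\sigma$-compact, then $\mathbb{R}\setminus A$ is countable and nowhere dense in $(\mathbb{R},\tau_A)$.
   Context: For $A\subset\mathbb{R}$, $\tau_A$ is the topology on $\mathbb{R}$ in which each $x\in A$ has neighborhood base $\{(x-\varepsilon,x+\varepsilon):\varepsilon>0\}$ and each $x\in\mathbb{R}\setminus A$ has neighborhood base $\{[x,x+\varepsilon):\varepsilon>0\}$. A space is $\sigma$-compact if it is the union of countably many compact subsets. *)

theory Defs
  imports "HOL-Analysis.Analysis"
begin

definition basic_nbhd :: "real set \<Rightarrow> real \<Rightarrow> real \<Rightarrow> real set" where
  "basic_nbhd A x \<epsilon> = (if x \<in> A then {x - \<epsilon><..<x + \<epsilon>} else {x..<x + \<epsilon>})"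

definition tau :: "real set \<Rightarrow> real topology" where
  "tau A = topology (\<lambda>U. \<forall>x\<in>U. \<exists>\<epsilon>>0. basic_nbhd A x \<epsilon> \<subseteq> U)"

definition sigma_compact_space :: "'a topology \<Rightarrow> bool" where
  "sigma_compact_space X \<longleftrightarrow>
     (\<exists>\<K>. countable \<K> \<and> (\<forall>K\<in>\<K>. compactin X K) \<and> \<Union>\<K> = topspace X)"

definition nowhere_dense_in :: "'a topology \<Rightarrow> 'a set \<Rightarrow> bool" where
  "nowhere_dense_in X S \<longleftrightarrow> S \<subseteq> topspace X \<and> X interior_of (X closure_of S) = {}"

lemma basic_nbhd_mono: "\<delta> \<le> \<epsilon> \<Longrightarrow> basic_nbhd A x \<delta> \<subseteq> basic_nbhd A x \<epsilon>"
  by (auto simp: basic_nbhd_def)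

lemma istopology_tau: "istopology (\<lambda>U. \<forall>x\<in>U. \<exists>\<epsilon>>0. basic_nbhd A x \<epsilon> \<subseteq> U)"
  unfolding istopology_def
proof (intro conjI allI impI)
  fix S T
  assume S: "\<forall>x\<in>S. \<exists>\<epsilon>>0. basic_nbhd A x \<epsilon> \<subseteq> S" and T: "\<forall>x\<in>T. \<exists>\<epsilon>>0. basic_nbhd A x \<epsilon> \<subseteq> T"
  show "\<forall>x\<in>S \<inter> T. \<exists>\<epsilon>>0. basic_nbhd A x \<epsilon> \<subseteq> S \<inter> T"
  proof
    fix x assume "x \<in> S \<inter> T"
    with S T obtain d e where "d > 0" "basic_nbhd A x d \<subseteq> S" "e > 0" "basic_nbhd A x e \<subseteq> T"
      by blast
    then show "\<exists>\<epsilon>>0. basic_nbhd A x \<epsilon> \<subseteq> S \<inter> T"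
      using basic_nbhd_mono[of "min d e" d A x] basic_nbhd_mono[of "min d e" e A x]
      by (intro exI[of _ "min d e"]) auto
  qed
next
  fix \<K> assume "\<forall>K\<in>\<K>. \<forall>x\<in>K. \<exists>\<epsilon>>0. basic_nbhd A x \<epsilon> \<subseteq> K"
  then show "\<forall>x\<in>\<Union>\<K>. \<exists>\<epsilon>>0. basic_nbhd A x \<epsilon> \<subseteq> \<Union>\<K>"
    by (meson Union_iff Union_upper subset_trans)
qed

lemma openin_tau: "openin (tau A) U \<longleftrightarrow> (\<forall>x\<in>U. \<exists>\<epsilon>>0. basic_nbhd A x \<epsilon> \<subseteq> U)"
  unfolding tau_def by (simp add: topology_inverse'[OF istopology_tau])

lemma topspace_tau [simp]: "topspace (tau A) = UNIV"
proof -
  have "openin (tau A) UNIV"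
    unfolding openin_tau using zero_less_one by blast
  then show ?thesis
    using openin_subset by blast
qed

lemma openin_basic_nbhd: "openin (tau A) (basic_nbhd A x \<epsilon>)"
  unfolding openin_tau
proof
  fix y assume y: "y \<in> basic_nbhd A x \<epsilon>"
  show "\<exists>\<delta>>0. basic_nbhd A y \<delta> \<subseteq> basic_nbhd A x \<epsilon>"
  proof (cases "y = x")
    case True
    with y show ?thesis
      by (intro exI[of _ \<epsilon>]) (auto simp: basic_nbhd_def split: if_splits)
  next
    case False
    with y show ?thesis
      by (intro exI[of _ "min \<bar>y - x\<bar> (\<epsilon> - \<bar>y - x\<bar>)"])
        (auto simp: basic_nbhd_def split: if_splits)
  qed
qed

text \<open>Together with openness of the basic neighborhoods, this says that they form a
  neighborhood base at each point, which determines the topology.\<close>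

lemma tau_neighborhood_base:
  "(\<exists>U. openin (tau A) U \<and> x \<in> U \<and> U \<subseteq> N) \<longleftrightarrow> (\<exists>\<epsilon>>0. basic_nbhd A x \<epsilon> \<subseteq> N)"
proof
  assume "\<exists>U. openin (tau A) U \<and> x \<in> U \<and> U \<subseteq> N"
  then show "\<exists>\<epsilon>>0. basic_nbhd A x \<epsilon> \<subseteq> N"
    unfolding openin_tau by (meson subset_trans)
next
  assume "\<exists>\<epsilon>>0. basic_nbhd A x \<epsilon> \<subseteq> N"
  then obtain \<epsilon> where "\<epsilon> > 0" "basic_nbhd A x \<epsilon> \<subseteq> N"
    by blast
  moreover from \<open>\<epsilon> > 0\<close> have "x \<in> basic_nbhd A x \<epsilon>"
    by (simp add: basic_nbhd_def)
  ultimately show "\<exists>U. openin (tau A) U \<and> x \<in> U \<and> U \<subseteq> N"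
    using openin_basic_nbhd by blast
qed

end

theory Submission
  imports Defs
begin

text \<open>If \<open>x \<notin> A\<close> then \<open>{x..}\<close> is open, so a compact set \<open>K\<close> containing \<open>x\<close> misses some interval
  \<open>{x - e<..<x}\<close>: otherwise \<open>{x..}\<close> and the sets \<open>{..<x - e}\<close> cover \<open>K\<close> without a finite subcover.
  Hence the points of \<open>K - A\<close> are isolated from the left and there are only countably many of them.
  If the complement of \<open>A\<close> were dense in an interval, then by Baire's theorem one of the countably
  many compact sets would contain a subinterval, and a point of this subinterval outside \<open>A\<close> would
  contradict the left gap.\<close>

lemma openin_tau_open:
  assumes "open U"
  shows "openin (tau A) U"
  unfolding openin_tau
proof
  fix x assume "x \<in> U"
  with assms obtain e where "e > 0" "ball x e \<subseteq> U"
    by (meson openE)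
  moreover have "basic_nbhd A x e \<subseteq> ball x e"
    by (auto simp: basic_nbhd_def dist_real_def)
  ultimately show "\<exists>\<epsilon>>0. basic_nbhd A x \<epsilon> \<subseteq> U"
    by blast
qed

lemma openin_tau_atLeast:
  assumes "x \<notin> A"
  shows "openin (tau A) {x..}"
  unfolding openin_tau
proof
  fix y assume "y \<in> {x..}"
  \<comment> \<open>For \<open>y > x\<close> the radius \<open>y - x\<close> keeps even a two-sided
    interval to the right of \<open>x\<close>. At \<open>y = x\<close> the neighborhood is half-open
    since \<open>x \<notin> A\<close>, so any radius will do.\<close>
  then show "\<exists>\<epsilon>>0. basic_nbhd A y \<epsilon> \<subseteq> {x..}"
    using assms
    by (intro exI[of _ "if y = x then 1 else y - x"]) (auto simp: basic_nbhd_def)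
qed

text \<open>\<open>tau A\<close> refines the Euclidean topology, so the identity maps compact sets
  to compact sets. This makes the members of the cover Euclidean closed, as the Baire argument
  requires.\<close>

lemma compactin_tau_imp_compact:
  assumes "compactin (tau A) K"
  shows "compact K"
proof -
  have "continuous_map (tau A) euclidean id"
    by (auto simp: continuous_map_def intro: openin_tau_open)
  from image_compactin[OF assms this] show ?thesis
    by simp
qed

lemma compactin_tau_left_gap:
  assumes K: "compactin (tau A) K" and x: "x \<notin> A"
  shows "\<exists>e>0. {x - e<..<x} \<inter> K = {}"
proof -
  define f where "f \<epsilon> = {..<x - \<epsilon>} \<union> {x..}" for \<epsilon>
  have "\<Union>(f ` {0<..}) = UNIV"
  proof -
    have "y \<in> \<Union>(f ` {0<..})" for y
    proof (cases "y < x")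
      case True
      then have "y \<in> f ((x - y) / 2)" "(x - y) / 2 \<in> {0<..}"
        by (auto simp: f_def field_simps)
      then show ?thesis
        by blast
    next
      case False
      then have "y \<in> f 1"
        by (simp add: f_def)
      then show ?thesis
        by (intro UN_I[of 1]) auto
    qed
    then show ?thesis
      by blast
  qed
  moreover have "openin (tau A) (f \<epsilon>)" for \<epsilon>
    unfolding f_def by (intro openin_Un openin_tau_open openin_tau_atLeast x) auto
  ultimately obtain \<F> where \<F>: "finite \<F>" "\<F> \<subseteq> f ` {0<..}" "K \<subseteq> \<Union>\<F>"
    using compactinD[OF K, of "f ` {0<..}"] by auto
  then obtain E where E: "finite E" "E \<subseteq> {0<..}" "\<F> = f ` E"
    by (meson finite_subset_image)
  \<comment> \<open>Inserting 1 keeps the minimum defined and positive when \<open>E\<close> is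
    empty.\<close>
  define e where "e = Min (insert 1 E)"
  have "e > 0"
    using E by (auto simp: e_def)
  moreover have "{x - e<..<x} \<inter> K = {}"
  proof -
    have "e \<le> \<epsilon>" if "\<epsilon> \<in> E" for \<epsilon>
      using that E(1) by (simp add: e_def)
    then have "f \<epsilon> \<inter> {x - e<..<x} = {}" if "\<epsilon> \<in> E" for \<epsilon>
      using that by (force simp: f_def)
    then show ?thesis
      using \<F>(3) E(3) by blast
  qed
  ultimately show ?thesis
    by blast
qed

text \<open>Choose a rational \<open>q x\<close> in the gap to the left of each \<open>x\<close>. If
  \<open>x < y\<close> in \<open>S\<close>, then \<open>x\<close> lies below the gap of
  \<open>y\<close>, so \<open>q x < x < q y\<close> and \<open>q\<close> is injective.\<close>

lemma countable_left_isolated: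
  fixes S :: "real set"
  assumes "\<And>x. x \<in> S \<Longrightarrow> \<exists>e>0. {x - e<..<x} \<inter> S = {}"
  shows "countable S"
proof -
  have "\<exists>q::rat. of_rat q < x \<and> {of_rat q..<x} \<inter> S = {}" if "x \<in> S" for x
  proof -
    from assms[OF that] obtain e where e: "e > 0" "{x - e<..<x} \<inter> S = {}"
      by blast
    then obtain q where "x - e < of_rat q" "of_rat q < x"
      using of_rat_dense[of "x - e" x] by auto
    with e show ?thesis
      by (intro exI[of _ q]) (auto simp: disjoint_iff)
  qed
  then obtain q :: "real \<Rightarrow> rat"
    where q: "of_rat (q x) < x" "{of_rat (q x)..<x} \<inter> S = {}" if "x \<in> S" for x
    by metis
  have "inj_on q S"
  proof (rule linorder_inj_onI')
    fix x y assume "x \<in> S" "y \<in> S" "x < y"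
    with q(1)[of x] q(2)[of y] show "q x \<noteq> q y"
      by (auto simp: disjoint_iff)
  qed
  then show ?thesis
    by (rule countableI')
qed

text \<open>Frontiers of closed sets have empty interior, so by Baire some point of \<open>U\<close>
  avoids the frontiers of all members of \<open>\<K>\<close>. It is then interior to any member that
  contains it.\<close>

lemma countable_closed_cover_interior:
  fixes U :: "'a::{real_normed_vector,heine_borel} set"
  assumes "countable \<K>" "\<And>K. K \<in> \<K> \<Longrightarrow> closed K" "U \<subseteq> \<Union>\<K>" "open U" "U \<noteq> {}"
  shows "\<exists>K\<in>\<K>. interior K \<inter> U \<noteq> {}"
proof -
  have "UNIV \<subseteq> closure (\<Inter>((\<lambda>K. - frontier K) ` \<K>))"
  proof (rule Baire)
    fix T assume "T \<in> (\<lambda>K. - frontier K) ` \<K>"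
    then obtain K where K: "K \<in> \<K>" "T = - frontier K"
      by blast
    have "interior (frontier K) \<subseteq> interior K"
      using assms(2) K(1) by (simp add: frontier_subset_closed interior_mono)
    then have "interior (frontier K) = {}"
      using interior_subset[of "frontier K"] by (auto simp: frontier_def)
    then show "openin (top_of_set UNIV) T \<and> UNIV \<subseteq> closure T"
      using K(2) by (simp add: closure_complement open_Compl)
  qed (use assms(1) in auto)
  then have "U \<inter> \<Inter>((\<lambda>K. - frontier K) ` \<K>) \<noteq> {}"
    using assms(4,5) open_Int_closure_eq_empty[OF assms(4)] by blast
  then obtain y where y: "y \<in> U" "\<And>K. K \<in> \<K> \<Longrightarrow> y \<notin> frontier K"
    by blast
  with assms(3) obtain K where K: "K \<in> \<K>" "y \<in> K"
    by blast
  with y(2) have "y \<in> interior K"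
    using closure_subset[of K] by (auto simp: frontier_def)
  with K(1) y(1) show ?thesis
    by blast
qed

theorem theorem3p13:
  fixes A :: "real set"
  assumes "sigma_compact_space (tau A)"
  shows "countable (UNIV - A) \<and> nowhere_dense_in (tau A) (UNIV - A)"
proof
  obtain \<K> where \<K>: "countable \<K>" "\<And>K. K \<in> \<K> \<Longrightarrow> compactin (tau A) K" "\<Union>\<K> = UNIV"
    using assms unfolding sigma_compact_space_def by auto
  have "countable (K - A)" if "K \<in> \<K>" for K
  proof (rule countable_left_isolated)
    fix x assume "x \<in> K - A"
    then show "\<exists>e>0. {x - e<..<x} \<inter> (K - A) = {}"
      using compactin_tau_left_gap[OF \<K>(2)[OF that], of x] by blast
  qed
  then have "countable (\<Union>K\<in>\<K>. K - A)"
    using \<K>(1) by blast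
  moreover have "(\<Union>K\<in>\<K>. K - A) = UNIV - A"
    using \<K>(3) by blast
  ultimately show "countable (UNIV - A)"
    by simp
  have "tau A interior_of (tau A closure_of (UNIV - A)) = {}"
  proof (rule ccontr)
    assume "tau A interior_of (tau A closure_of (UNIV - A)) \<noteq> {}"
    then obtain W x where W: "openin (tau A) W" "x \<in> W" "W \<subseteq> tau A closure_of (UNIV - A)"
      by (auto simp: interior_of_def)
    then obtain e where "e > 0" "basic_nbhd A x e \<subseteq> W"
      by (auto simp: openin_tau)
    \<comment> \<open>Dropping the left half and the point \<open>x\<close> leaves a Euclidean open
      interval whether or not \<open>x \<in> A\<close>.\<close>
    moreover have "{x<..<x + e} \<subseteq> basic_nbhd A x e"
      using \<open>e > 0\<close> by (auto simp: basic_nbhd_def)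
    ultimately have dense: "{x<..<x + e} \<subseteq> tau A closure_of (UNIV - A)"
      using W(3) by blast
    have "closed K" if "K \<in> \<K>" for K
      using \<K>(2)[OF that] by (intro compact_imp_closed compactin_tau_imp_compact)
    then obtain K where K: "K \<in> \<K>" "interior K \<inter> {x<..<x + e} \<noteq> {}"
      using countable_closed_cover_interior[of \<K> "{x<..<x + e}"] \<K>(1,3) \<open>e > 0\<close> by auto
    define V where "V = interior K \<inter> {x<..<x + e}"
    have "open V"
      by (simp add: V_def open_Int)
    from K(2) obtain y where "y \<in> V"
      unfolding V_def by blast
    with dense have "y \<in> tau A closure_of (UNIV - A)"
      by (auto simp: V_def)
    \<comment> \<open>\<open>V\<close> is also open in \<open>tau A\<close>, so this neighborhood of
      a point of the closure meets the complement of \<open>A\<close>.\<close>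
    with openin_tau_open[OF \<open>open V\<close>] \<open>y \<in> V\<close> obtain b where b: "b \<in> V" "b \<notin> A"
      by (auto simp: in_closure_of)
    from compactin_tau_left_gap[OF \<K>(2)[OF K(1)] b(2)]
    obtain d where d: "d > 0" "{b - d<..<b} \<inter> K = {}"
      by blast
    from \<open>open V\<close> b(1) obtain r where r: "r > 0" "ball b r \<subseteq> V"
      by (meson openE)
    \<comment> \<open>This point is close enough to \<open>b\<close> to lie in \<open>V\<close>,
      hence in \<open>K\<close>, and also in the gap of length \<open>d\<close> to the left of
      \<open>b\<close>.\<close>
    have "b - min d r / 2 \<in> ball b r"
      using d(1) r(1) by (auto simp: dist_real_def)
    with r(2) have "b - min d r / 2 \<in> K"
      using interior_subset[of K] unfolding V_def by blast
    moreover have "b - min d r / 2 \<in> {b - d<..<b}"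
      using d(1) r(1) by auto
    ultimately show False
      using d(2) by blast
  qed
  then show "nowhere_dense_in (tau A) (UNIV - A)"
    by (simp add: nowhere_dense_in_def)
qed

end
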